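(* Let $L\subset\mathbb{R}^n$ be a full-rank lattice with basis matrix $\mathrm{B}\in\mathbb{R}^{n\times n}$, let $t\in\mathbb{R}^n$ be a target vector, let $\textsf{BDD}_{\alpha}$ be an $\alpha$-BDD oracle with $\alpha<0.5$, and let $p$ be an integer with $p\alpha>1$. Consider the algorithm $\textsf{Enum}$ that, for every $s\in\mathbb{Z}_p^n=\{0,1,\dots,p-1\}^n$, computes and outputs the vector \[ -p\cdot\textsf{BDD}_{\alpha}\!\left(L,\tfrac{\mathrm{B}s-t}{p}\right)+\mathrm{B}s . \] Then the list output by $\textsf{Enum}$ contains all lattice points of $L$ within distance $p\alpha\lambda_1(L)$ of $t$ (possibly together with other lattice points); in particular $\textsf{Enum}$ makes $p^n$ queries to $\textsf{BDD}_\alpha$.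
   Context: A lattice $L$ with basis matrix $\mathrm{B}=[b_1\cdots b_n]$ (columns linearly independent) is $\{\mathrm{B}x:x\in\mathbb{Z}^n\}$. $\|\cdot\|$ is the Euclidean norm, $\mathrm{dist}(t,L)=\min_{x\in L}\|t-x\|$, and $\lambda_1(L)$ is the length of a shortest nonzero vector of $L$. For $\alpha<1/2$, an $\alpha$-BDD oracle $\textsf{BDD}_\alpha$ takes a (basis of a) lattice $\Lambda\subset\mathbb{R}^n$ and a target $t'\in\mathbb{R}^n$ with $\mathrm{dist}(\Lambda,t')\le\alpha\lambda_1(\Lambda)$ and returns a vector $v\in\Lambda$ with $\|v-t'\|\le\alpha\lambda_1(\Lambda)$. *)

theory Defs
  imports "HOL-Analysis.Analysis"
begin

definition of_int_vec :: "int ^ 'm \<Rightarrow> real ^ 'm" where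
  "of_int_vec x = (\<chi> i. real_of_int (x $ i))"

text \<open>Injectivity makes this linear independence of the family of columns: a repeated column
  would be invisible in the set \<^term>\<open>columns B\<close>.\<close>

definition lattice_basis :: "real ^ 'm ^ 'n \<Rightarrow> bool" where
  "lattice_basis B \<longleftrightarrow> inj (\<lambda>j. column j B) \<and> independent (columns B)"

definition lattice_of :: "real ^ 'm ^ 'n \<Rightarrow> (real ^ 'n) set" where
  "lattice_of B = {B *v of_int_vec x | x. True}"

definition lambda1 :: "(real ^ 'n) set \<Rightarrow> real" where
  "lambda1 L = Inf {norm v | v. v \<in> L \<and> v \<noteq> 0}"

text \<open>An oracle maps a basis matrix of a full-rank lattice and a target to a vector. Nothing is
  required of the answer outside the promise, not even that it is a lattice vector.\<close>

definition BDD_oracle :: "real \<Rightarrow> ((real ^ 'n ^ 'n) \<times> (real ^ 'n) \<Rightarrow> real ^ 'n) \<Rightarrow> bool" where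
  "BDD_oracle \<alpha> BDD \<longleftrightarrow>
     (\<forall>M t'. lattice_basis M \<and> infdist t' (lattice_of M) \<le> \<alpha> * lambda1 (lattice_of M) \<longrightarrow>
        BDD (M, t') \<in> lattice_of M \<and>
        norm (BDD (M, t') - t') \<le> \<alpha> * lambda1 (lattice_of M))"

text \<open>Programs with access to an oracle that answers queries of type \<^typ>\<open>'q\<close> by values of type
  \<^typ>\<open>'r\<close>. Running a program yields its result and the list of the queries it has made.\<close>

datatype ('q, 'r, 'a) oracle_program =
    Return 'a
  | Query 'q "'r \<Rightarrow> ('q, 'r, 'a) oracle_program"

primrec run_with :: "('q \<Rightarrow> 'r) \<Rightarrow> ('q, 'r, 'a) oracle_program \<Rightarrow> 'a \<times> 'q list" where
  "run_with orc (Return a) = (a, [])"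
| "run_with orc (Query q k) = (case run_with orc (k (orc q)) of (a, qs) \<Rightarrow> (a, q # qs))"

definition Zp_vecs :: "int \<Rightarrow> (int ^ 'n) set" where
  "Zp_vecs p = {s. \<forall>i. s $ i \<in> {0..p - 1}}"

text \<open>The list argument is the order in which the vectors \<open>s\<close> are processed, \<open>out\<close> is the
  list of vectors output so far.\<close>

fun enum_loop ::
  "real ^ 'n ^ 'n \<Rightarrow> real ^ 'n \<Rightarrow> int \<Rightarrow> (int ^ 'n) list \<Rightarrow> (real ^ 'n) list \<Rightarrow>
   ((real ^ 'n ^ 'n) \<times> (real ^ 'n), real ^ 'n, (real ^ 'n) list) oracle_program" where
  "enum_loop B t p [] out = Return out"
| "enum_loop B t p (s # ss) out =
     Query (B, (B *v of_int_vec s - t) /\<^sub>R real_of_int p)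
       (\<lambda>v. enum_loop B t p ss (out @ [- (real_of_int p *\<^sub>R v) + B *v of_int_vec s]))"

definition Enum ::
  "real ^ 'n ^ 'n \<Rightarrow> real ^ 'n \<Rightarrow> int \<Rightarrow> (int ^ 'n) list \<Rightarrow>
   ((real ^ 'n ^ 'n) \<times> (real ^ 'n), real ^ 'n, (real ^ 'n) list) oracle_program" where
  "Enum B t p ss = enum_loop B t p ss []"

end

theory Submission
  imports Defs
begin

text \<open>Let \<open>v = B x\<close> be a lattice point within \<open>p \<alpha> \<lambda>\<^sub>1\<close> of \<open>t\<close> and write \<open>x = p y + s\<close> with
  \<open>s\<close> the residue of \<open>x\<close> modulo \<open>p\<close>. The query target for \<open>s\<close> differs from the lattice point
  \<open>- B y\<close> by \<open>(v - t) / p\<close>, so it satisfies the promise. As \<open>2 \<alpha> < 1\<close>, the only lattice point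
  within \<open>\<alpha> \<lambda>\<^sub>1\<close> of the target is \<open>- B y\<close>, hence the output for \<open>s\<close> is \<open>p B y + B s = v\<close>.\<close>

lemma of_int_vec_add: "of_int_vec (x + y) = of_int_vec x + of_int_vec y"
  by (simp add: of_int_vec_def vec_eq_iff)

lemma of_int_vec_diff: "of_int_vec (x - y) = of_int_vec x - of_int_vec y"
  by (simp add: of_int_vec_def vec_eq_iff)

lemma of_int_vec_scale: "of_int_vec (k *s x) = real_of_int k *\<^sub>R of_int_vec x"
  by (simp add: of_int_vec_def vec_eq_iff)

lemma of_int_vec_zero [simp]: "of_int_vec 0 = 0"
  by (simp add: of_int_vec_def vec_eq_iff)

lemma of_int_vec_axis: "of_int_vec (axis i 1) = axis i 1"
  by (simp add: of_int_vec_def vec_eq_iff axis_def)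

lemma norm_of_int_vec_ge_1:
  assumes "x \<noteq> 0"
  shows "1 \<le> norm (of_int_vec x)"
proof -
  obtain i where "x $ i \<noteq> 0"
    using assms by (auto simp: vec_eq_iff)
  then have "1 \<le> \<bar>of_int_vec x $ i\<bar>"
    by (simp add: of_int_vec_def)
  also have "\<dots> \<le> norm (of_int_vec x)"
    by (rule component_le_norm_cart)
  finally show ?thesis .
qed

lemma lattice_of_memI: "B *v of_int_vec x \<in> lattice_of B"
  by (auto simp: lattice_of_def)

lemma lattice_of_diff:
  assumes "u \<in> lattice_of B" "v \<in> lattice_of B"
  shows "u - v \<in> lattice_of B"
proof -
  obtain x y where "u = B *v of_int_vec x" "v = B *v of_int_vec y"
    using assms by (auto simp: lattice_of_def)
  then have "u - v = B *v of_int_vec (x - y)"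
    by (simp add: of_int_vec_diff matrix_vector_mult_diff_distrib)
  then show ?thesis
    by (simp add: lattice_of_memI)
qed

lemma lattice_of_scale:
  assumes "u \<in> lattice_of B"
  shows "real_of_int k *\<^sub>R u \<in> lattice_of B"
proof -
  obtain x where "u = B *v of_int_vec x"
    using assms by (auto simp: lattice_of_def)
  then have "real_of_int k *\<^sub>R u = B *v of_int_vec (k *s x)"
    by (simp add: of_int_vec_scale matrix_vector_mult_scaleR)
  then show ?thesis
    by (simp add: lattice_of_memI)
qed

lemma lattice_of_minus:
  assumes "u \<in> lattice_of B"
  shows "- u \<in> lattice_of B"
  using lattice_of_scale[OF assms, of "- 1"] by simp

text \<open>Independence is stated for the set \<open>columns B\<close>, whereas
  \<open>B *v x\<close> has coefficients indexed by column numbers. Injectivity of the columns lets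
  the coefficients be moved onto the set.\<close>

lemma lattice_basis_mult_eq_0:
  fixes B :: "real ^ 'm ^ 'n"
  assumes "lattice_basis B" "B *v x = 0"
  shows "x = 0"
proof -
  have inj: "inj (\<lambda>j. column j B)" and ind: "independent (columns B)"
    using assms(1) by (auto simp: lattice_basis_def)
  have cols: "columns B = range (\<lambda>j. column j B)"
    by (auto simp: columns_def)
  define u where "u v = x $ inv (\<lambda>j. column j B) v" for v
  have u: "u (column j B) = x $ j" for j
    using inv_f_f[OF inj, of j] by (simp add: u_def)
  have "(\<Sum>v\<in>columns B. u v *\<^sub>R v) = (\<Sum>j\<in>UNIV. x $ j *\<^sub>R column j B)"
    unfolding cols by (subst sum.reindex[OF inj]) (simp add: u)
  also have "\<dots> = 0"
    using assms(2) by (simp add: matrix_mult_sum scalar_mult_eq_scaleR)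
  finally have "(\<Sum>v\<in>columns B. u v *\<^sub>R v) = 0" .
  then have "u (column j B) = 0" for j
    using independentD[OF ind _ subset_refl] cols by auto
  then show ?thesis
    by (simp add: u vec_eq_iff)
qed

lemma lambda1_le_norm:
  assumes "v \<in> L" "v \<noteq> 0"
  shows "lambda1 L \<le> norm v"
  unfolding lambda1_def
proof (rule cInf_lower)
  show "bdd_below {norm v |v. v \<in> L \<and> v \<noteq> 0}"
    by (rule bdd_belowI[of _ 0]) auto
qed (use assms in blast)

text \<open>An injective linear map satisfies \<open>c * norm x \<le> norm (B *v x)\<close> for some
  c > 0, and a nonzero integer vector has norm at least 1. So c bounds all nonzero lattice vectors
  from below.\<close>

lemma lambda1_pos:
  fixes B :: "real ^ 'm ^ 'n"
  assumes "lattice_basis B"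
  shows "0 < lambda1 (lattice_of B)"
proof -
  have lin: "linear ((*v) B)"
    by (rule matrix_vector_mul_linear)
  have "inj ((*v) B)"
    using lattice_basis_mult_eq_0[OF assms] by (simp add: linear_injective_0[OF lin])
  then obtain c where c: "c > 0" "\<And>x. c * norm x \<le> norm (B *v x)"
    using linear_inj_bounded_below_pos[OF lin] by blast
  have "c \<le> norm v" if mem: "v \<in> lattice_of B" and nz: "v \<noteq> 0" for v
  proof -
    obtain x where v: "v = B *v of_int_vec x"
      using mem by (auto simp: lattice_of_def)
    with nz have "x \<noteq> 0" by auto
    then have "c * 1 \<le> c * norm (of_int_vec x)"
      using c(1) by (intro mult_left_mono norm_of_int_vec_ge_1) auto
    also have "\<dots> \<le> norm v"
      unfolding v by (rule c(2))
    finally show ?thesis by simp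
  qed
  \<comment> \<open>The infimum can be bounded from below by c only over a nonempty set. The image
    of a unit vector supplies an element; \<open>undefined\<close> stands for an arbitrary
    index.\<close>
  moreover have "\<exists>v. v \<in> lattice_of B \<and> v \<noteq> 0"
  proof (intro exI conjI)
    show "B *v of_int_vec (axis undefined 1) \<in> lattice_of B"
      by (rule lattice_of_memI)
    show "B *v of_int_vec (axis undefined 1) \<noteq> 0"
      using lattice_basis_mult_eq_0[OF assms, of "axis undefined 1"]
      by (auto simp: of_int_vec_axis)
  qed
  ultimately have "c \<le> lambda1 (lattice_of B)"
    unfolding lambda1_def by (intro cInf_greatest) auto
  with c(1) show ?thesis by simp
qed

text \<open>Unique decoding: two distinct such points would differ by a nonzero lattice vector of
  norm at most 2 \<alpha> \<open>lambda1\<close>, which is less than \<open>lambda1\<close>.\<close>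

lemma lattice_point_eqI:
  assumes "lattice_basis B" "\<alpha> < 1 / 2" "u \<in> lattice_of B" "w \<in> lattice_of B"
    and "norm (u - z) \<le> \<alpha> * lambda1 (lattice_of B)"
    and "norm (w - z) \<le> \<alpha> * lambda1 (lattice_of B)"
  shows "u = w"
proof (rule ccontr)
  let ?l = "lambda1 (lattice_of B)"
  assume "u \<noteq> w"
  then have "?l \<le> norm (u - w)"
    using assms(3,4) by (intro lambda1_le_norm lattice_of_diff) auto
  also have "\<dots> \<le> norm (u - z) + norm (w - z)"
    using norm_triangle_ineq4[of "u - z" "w - z"] by simp
  also have "\<dots> \<le> 2 * \<alpha> * ?l"
    using assms(5,6) by simp
  also have "\<dots> < 1 * ?l"
    using assms(2) lambda1_pos[OF assms(1)] by (intro mult_strict_right_mono) auto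
  finally show False by simp
qed

text \<open>The point \<open>w\<close> itself witnesses the promise, so the oracle must answer
  within the radius where decoding is unique.\<close>

lemma BDD_oracle_eq:
  assumes "lattice_basis B" "\<alpha> < 1 / 2" "BDD_oracle \<alpha> BDD"
    and "w \<in> lattice_of B" "norm (w - z) \<le> \<alpha> * lambda1 (lattice_of B)"
  shows "BDD (B, z) = w"
proof -
  have "infdist z (lattice_of B) \<le> dist z w"
    by (rule infdist_le[OF assms(4)])
  also have "\<dots> \<le> \<alpha> * lambda1 (lattice_of B)"
    using assms(5) by (simp add: dist_norm norm_minus_commute)
  finally have "BDD (B, z) \<in> lattice_of B \<and>
      norm (BDD (B, z) - z) \<le> \<alpha> * lambda1 (lattice_of B)"
    using assms(1,3) by (auto simp: BDD_oracle_def)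
  then show ?thesis
    using assms by (blast intro: lattice_point_eqI)
qed

lemma card_vec_components_in:
  fixes A :: "'a set"
  shows "card {s :: 'a ^ 'n. \<forall>i. s $ i \<in> A} = card A ^ CARD('n)"
proof -
  have "bij_betw vec_nth {s :: 'a ^ 'n. \<forall>i. s $ i \<in> A} (PiE UNIV (\<lambda>_. A))"
    by (rule bij_betwI[where g = vec_lambda]) auto
  then have "card {s :: 'a ^ 'n. \<forall>i. s $ i \<in> A} = card (PiE (UNIV :: 'n set) (\<lambda>_. A))"
    by (rule bij_betw_same_card)
  then show ?thesis
    by (simp add: card_PiE)
qed

lemma card_Zp_vecs: "card (Zp_vecs p :: (int ^ 'n) set) = nat p ^ CARD('n)"
  unfolding Zp_vecs_def card_vec_components_in by simp

text \<open>No query depends on an earlier answer, so outputs and queries are both maps over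
  \<open>ss\<close>. The accumulator \<open>out\<close> stays general for the induction.\<close>

lemma run_with_enum_loop:
  "run_with BDD (enum_loop B t p ss out) =
     (out @ map (\<lambda>s. - (real_of_int p *\<^sub>R BDD (B, (B *v of_int_vec s - t) /\<^sub>R real_of_int p))
        + B *v of_int_vec s) ss,
      map (\<lambda>s. (B, (B *v of_int_vec s - t) /\<^sub>R real_of_int p)) ss)"
  by (induction ss arbitrary: out) simp_all

lemma Enum_output_eq:
  fixes B :: "real ^ 'n ^ 'n"
  assumes "lattice_basis B" "\<alpha> < 1 / 2" "BDD_oracle \<alpha> BDD" "0 < p"
    and v: "v = B *v of_int_vec (p *s y + s)"
    and near: "norm (v - t) \<le> real_of_int p * \<alpha> * lambda1 (lattice_of B)"
  shows "- (real_of_int p *\<^sub>R BDD (B, (B *v of_int_vec s - t) /\<^sub>R real_of_int p))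
    + B *v of_int_vec s = v"
proof -
  define w where "w = - (B *v of_int_vec y)"
  define z where "z = (B *v of_int_vec s - t) /\<^sub>R real_of_int p"
  have v': "v = B *v of_int_vec s - real_of_int p *\<^sub>R w"
    unfolding v w_def of_int_vec_add of_int_vec_scale
    by (simp add: matrix_vector_right_distrib matrix_vector_mult_scaleR)
  \<comment> \<open>Division by p shrinks the search radius p \<alpha> \<open>lambda1\<close> around
    \<open>t\<close> to the decoding radius \<alpha> \<open>lambda1\<close> around
    \<open>z\<close>.\<close>
  have "w - z = - ((v - t) /\<^sub>R real_of_int p)"
    using \<open>0 < p\<close> by (simp add: v' z_def algebra_simps)
  then have "norm (w - z) = norm (v - t) / real_of_int p"
    using \<open>0 < p\<close> by (simp add: divide_inverse_commute)
  also have "\<dots> \<le> \<alpha> * lambda1 (lattice_of B)"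
    using near \<open>0 < p\<close> by (simp add: pos_divide_le_eq mult_ac)
  finally have "BDD (B, z) = w"
    using assms(1-3) by (intro BDD_oracle_eq) (auto simp: w_def lattice_of_minus lattice_of_memI)
  then show ?thesis
    by (simp add: v' z_def)
qed

theorem theorem8:
  fixes B :: "real ^ 'n ^ 'n"
    and L :: "(real ^ 'n) set"
    and t :: "real ^ 'n"
    and \<alpha> :: real
    and p :: int
    and BDD :: "(real ^ 'n ^ 'n) \<times> (real ^ 'n) \<Rightarrow> real ^ 'n"
    and ss :: "(int ^ 'n) list"
    and out :: "(real ^ 'n) list"
    and queries :: "((real ^ 'n ^ 'n) \<times> (real ^ 'n)) list"
  assumes "lattice_basis B"
    and "L = lattice_of B"
    and "0 < \<alpha>" and "\<alpha> < 1 / 2"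
    and "BDD_oracle \<alpha> BDD"
    and "real_of_int p * \<alpha> > 1"
    and "distinct ss" and "set ss = Zp_vecs p"
    and "run_with BDD (Enum B t p ss) = (out, queries)"
  shows "{v \<in> L. norm (v - t) \<le> real_of_int p * \<alpha> * lambda1 L} \<subseteq> set out
    \<and> list_all2 (\<lambda>q w. BDD q \<in> L \<longrightarrow> w \<in> L) queries out
    \<and> length queries = nat p ^ CARD('n)"
proof (intro conjI)
  have p: "0 < p"
    using assms(3,6) by (metis less_trans mult_less_cancel_right of_int_0_less_iff
        zero_less_one zero_less_mult_pos2)
  define q where "q s = (B, (B *v of_int_vec s - t) /\<^sub>R real_of_int p)" for s
  define f where "f s = - (real_of_int p *\<^sub>R BDD (q s)) + B *v of_int_vec s" for s
  have out: "out = map f ss" and queries: "queries = map q ss"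
    using assms(9) by (auto simp: Enum_def run_with_enum_loop f_def q_def)
  show "{v \<in> L. norm (v - t) \<le> real_of_int p * \<alpha> * lambda1 L} \<subseteq> set out"
  proof safe
    fix v
    assume "v \<in> L" and near: "norm (v - t) \<le> real_of_int p * \<alpha> * lambda1 L"
    then obtain x where x: "v = B *v of_int_vec x"
      by (auto simp: assms(2) lattice_of_def)
    \<comment> \<open>Since p > 0, \<open>mod\<close> yields entries in 0..p-1 even for negative
      coordinates, so \<open>s\<close> is among the enumerated vectors.\<close>
    define s where "s = (\<chi> i. x $ i mod p)"
    define y where "y = (\<chi> i. x $ i div p)"
    have "x = p *s y + s"
      by (simp add: s_def y_def vec_eq_iff)
    then have "f s = v"
      using Enum_output_eq[OF assms(1,4,5) p, of v y s t] near x
      by (simp add: f_def q_def assms(2))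
    moreover have "s \<in> set ss"
      using p by (simp add: assms(8) Zp_vecs_def s_def)
    ultimately show "v \<in> set out"
      by (auto simp: out)
  qed
  \<comment> \<open>An output is an integer combination of the oracle's answer and a lattice vector.
    The answer is assumed to lie in L because a query may violate the promise.\<close>
  have "f s \<in> L" if "BDD (q s) \<in> L" for s
  proof -
    have "B *v of_int_vec s - real_of_int p *\<^sub>R BDD (q s) \<in> lattice_of B"
      using that by (intro lattice_of_diff lattice_of_memI lattice_of_scale) (simp add: assms(2))
    then show ?thesis
      by (simp add: f_def assms(2))
  qed
  then show "list_all2 (\<lambda>q w. BDD q \<in> L \<longrightarrow> w \<in> L) queries out"
    by (simp add: out queries list_all2_conv_all_nth)
  \<comment> \<open>There is one query per entry of \<open>ss\<close>, and distinctness turns this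
    length into the cardinality of \<open>Zp_vecs p\<close>.\<close>
  show "length queries = nat p ^ CARD('n)"
    using distinct_card[OF assms(7)] by (simp add: queries assms(8) card_Zp_vecs)
qed

end
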